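(* Every capped graph on $n$ vertices admits a biclique cover of size $O(n\log^3 n)$; that is, there is an absolute constant $C$ such that every capped graph on $n\ge 2$ vertices has a biclique cover of size at most $C\,n\log^3 n$.
   Context: All graphs are finite and simple. A biclique is a complete bipartite graph. A biclique cover of a graph $G$ is a collection $\mathcal{H}$ of (not necessarily induced) subgraphs of $G$, each of which is a biclique, such that every edge of $G$ belongs to at least one member of $\mathcal{H}$. The size of $\mathcal{H}$ is $\sum_{H\in\mathcal{H}}|V(H)|$. An ordered graph is a graph whose vertex set is totally ordered; one may take the vertex set to be $[n]=\{1,\ldots,n\}$ with the natural order. An ordered graph $([n],E)$ is a capped graph (also called terrain-like graph) if for any four vertices $i<j<k<\ell$, if $ik\in E$ and $j\ell\in E$, then $i\ell\in E$. *)

theory Defs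
  imports Complex_Main
begin

text \<open>A graph is a pair of a vertex set and a set of two-element edges.\<close>

type_synonym 'a graph = "'a set \<times> 'a set set"

abbreviation verts :: "'a graph \<Rightarrow> 'a set" where
  "verts G \<equiv> fst G"

abbreviation edges :: "'a graph \<Rightarrow> 'a set set" where
  "edges G \<equiv> snd G"

definition simple_graph :: "'a graph \<Rightarrow> bool" where
  "simple_graph G \<longleftrightarrow>
     finite (verts G) \<and> (\<forall>e \<in> edges G. e \<subseteq> verts G \<and> card e = 2)"

definition subgraph :: "'a graph \<Rightarrow> 'a graph \<Rightarrow> bool" where
  "subgraph H G \<longleftrightarrow>
     simple_graph H \<and> simple_graph G \<and> verts H \<subseteq> verts G \<and> edges H \<subseteq> edges G"

text \<open>Both sides of a biclique are required to be nonempty. Bicliques with an empty side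
  have no edges, so excluding them does not affect which edges can be covered.\<close>

definition biclique :: "'a graph \<Rightarrow> bool" where
  "biclique H \<longleftrightarrow> simple_graph H \<and>
     (\<exists>A B. A \<noteq> {} \<and> B \<noteq> {} \<and> A \<inter> B = {} \<and> verts H = A \<union> B \<and>
            edges H = {{a, b} | a b. a \<in> A \<and> b \<in> B})"

definition biclique_cover :: "'a graph \<Rightarrow> 'a graph set \<Rightarrow> bool" where
  "biclique_cover G \<H> \<longleftrightarrow>
     (\<forall>H \<in> \<H>. subgraph H G \<and> biclique H) \<and> (\<forall>e \<in> edges G. \<exists>H \<in> \<H>. e \<in> edges H)"

definition cover_size :: "'a graph set \<Rightarrow> nat" where
  "cover_size \<H> = (\<Sum>H \<in> \<H>. card (verts H))"

text \<open>The sum defining the size of a biclique cover of a finite graph never degenerates:\<close>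

lemma finite_biclique_cover:
  assumes "simple_graph G" "biclique_cover G \<H>"
  shows "finite \<H>"
proof (rule finite_subset)
  show "\<H> \<subseteq> Pow (verts G) \<times> Pow (Pow (verts G))"
    using assms unfolding biclique_cover_def subgraph_def simple_graph_def by fastforce
  show "finite (Pow (verts G) \<times> Pow (Pow (verts G)))"
    using assms by (simp add: simple_graph_def)
qed

definition capped_graph :: "'a::linorder graph \<Rightarrow> bool" where
  "capped_graph G \<longleftrightarrow> simple_graph G \<and>
     (\<forall>i \<in> verts G. \<forall>j \<in> verts G. \<forall>k \<in> verts G. \<forall>l \<in> verts G.
        i < j \<and> j < k \<and> k < l \<and> {i, k} \<in> edges G \<and> {j, l} \<in> edges G \<longrightarrow> {i, l} \<in> edges G)"

end

theory Submission
  imports Defs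
begin

text \<open>
  If all of \<open>X\<close> precedes all of \<open>Y\<close>, the capped condition says that a non-edge \<open>i l\<close> with
  \<open>i \<in> X\<close>, \<open>l \<in> Y\<close> either has no edge from \<open>i\<close> to a smaller vertex of \<open>Y\<close>, or no edge from \<open>l\<close>
  to a larger vertex of \<open>X\<close>. Hence \<open>i l\<close> is an edge iff \<open>p i \<le> l\<close> and \<open>i \<le> q l\<close>, where \<open>p i\<close> is
  the least neighbour of \<open>i\<close> in \<open>Y\<close> and \<open>q l\<close> the greatest neighbour of \<open>l\<close> in \<open>X\<close>.
  A comparison \<open>f a < g b\<close> of numbers below \<open>2 ^ m\<close> can be resolved into products of sets by
  recursion on the leading bit, at the price of a factor \<open>m\<close> in the total size. Doing this for
  \<open>a < b\<close>, then for \<open>p a \<le> b\<close>, and then for \<open>a \<le> q b\<close> costs three logarithmic factors.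
\<close>

section \<open>Rectangle covers of a relation and their total size\<close>

definition rectangle_cover ::
    "('a \<Rightarrow> 'b \<Rightarrow> bool) \<Rightarrow> 'a set \<Rightarrow> 'b set \<Rightarrow> ('a set \<times> 'b set) set \<Rightarrow> bool" where
  "rectangle_cover R A B S \<longleftrightarrow> finite S \<and>
     (\<forall>X Y. (X, Y) \<in> S \<longrightarrow> X \<subseteq> A \<and> Y \<subseteq> B \<and> (\<forall>x \<in> X. \<forall>y \<in> Y. R x y)) \<and>
     (\<forall>a \<in> A. \<forall>b \<in> B. R a b \<longrightarrow> (\<exists>X Y. (X, Y) \<in> S \<and> a \<in> X \<and> b \<in> Y))"

lemma rectangle_coverD:
  assumes "rectangle_cover R A B S"
  shows "finite S"
    and "(X, Y) \<in> S \<Longrightarrow> X \<subseteq> A"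
    and "(X, Y) \<in> S \<Longrightarrow> Y \<subseteq> B"
    and "(X, Y) \<in> S \<Longrightarrow> x \<in> X \<Longrightarrow> y \<in> Y \<Longrightarrow> R x y"
    and "a \<in> A \<Longrightarrow> b \<in> B \<Longrightarrow> R a b \<Longrightarrow> \<exists>X Y. (X, Y) \<in> S \<and> a \<in> X \<and> b \<in> Y"
  using assms unfolding rectangle_cover_def by simp_all

definition coverable :: "('a \<Rightarrow> 'b \<Rightarrow> bool) \<Rightarrow> 'a set \<Rightarrow> 'b set \<Rightarrow> nat \<Rightarrow> bool" where
  "coverable R A B s \<longleftrightarrow>
     (\<exists>S. rectangle_cover R A B S \<and> (\<Sum>(X, Y) \<in> S. card X + card Y) \<le> s)"

lemma coverable_none:
  assumes "\<And>a b. a \<in> A \<Longrightarrow> b \<in> B \<Longrightarrow> \<not> R a b"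
  shows "coverable R A B s"
  unfolding coverable_def rectangle_cover_def using assms by (intro exI[of _ "{}"]) auto

lemma coverable_all:
  assumes "\<And>a b. a \<in> A \<Longrightarrow> b \<in> B \<Longrightarrow> R a b"
  shows "coverable R A B (card A + card B)"
  unfolding coverable_def rectangle_cover_def using assms by (intro exI[of _ "{(A, B)}"]) auto

lemma coverable_mono:
  assumes "coverable R A B s" "s \<le> t"
  shows "coverable R A B t"
  using assms unfolding coverable_def by (meson le_trans)

lemma coverable_cong:
  assumes "\<And>a b. a \<in> A \<Longrightarrow> b \<in> B \<Longrightarrow> R a b \<longleftrightarrow> R' a b"
  shows "coverable R A B s \<longleftrightarrow> coverable R' A B s"
proof -
  have "(\<forall>x \<in> X. \<forall>y \<in> Y. R x y) \<longleftrightarrow> (\<forall>x \<in> X. \<forall>y \<in> Y. R' x y)"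
    if "X \<subseteq> A" "Y \<subseteq> B" for X Y
    using assms that by (intro ball_cong refl) auto
  then have "rectangle_cover R A B S \<longleftrightarrow> rectangle_cover R' A B S" for S
    unfolding rectangle_cover_def using assms by (simp cong: conj_cong)
  then show ?thesis
    unfolding coverable_def by simp
qed

text \<open>The union of the two covers works: shared rectangles are counted once, and a pair in
  neither block violates \<open>R\<close>.\<close>

lemma coverable_join:
  assumes "coverable R A1 B1 s1" "coverable R A2 B2 s2"
    and "A1 \<subseteq> A" "B1 \<subseteq> B" "A2 \<subseteq> A" "B2 \<subseteq> B"
    and split: "\<And>a b. a \<in> A \<Longrightarrow> b \<in> B \<Longrightarrow> R a b \<Longrightarrow> a \<in> A1 \<and> b \<in> B1 \<or> a \<in> A2 \<and> b \<in> B2"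
  shows "coverable R A B (s1 + s2)"
proof -
  obtain S1 S2 where S1: "rectangle_cover R A1 B1 S1" "(\<Sum>(X, Y) \<in> S1. card X + card Y) \<le> s1"
    and S2: "rectangle_cover R A2 B2 S2" "(\<Sum>(X, Y) \<in> S2. card X + card Y) \<le> s2"
    using assms(1,2) unfolding coverable_def by auto
  have fin: "finite S1" "finite S2"
    using rectangle_coverD(1) S1(1) S2(1) by blast+
  have "rectangle_cover R A B (S1 \<union> S2)"
    unfolding rectangle_cover_def
  proof (intro conjI allI ballI impI)
    fix a b
    assume ab: "a \<in> A" "b \<in> B" "R a b"
    from split[OF this] show "\<exists>X Y. (X, Y) \<in> S1 \<union> S2 \<and> a \<in> X \<and> b \<in> Y"
      using rectangle_coverD(5)[OF S1(1) _ _ ab(3)] rectangle_coverD(5)[OF S2(1) _ _ ab(3)]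
      by (meson UnI1 UnI2)
  next
    fix X Y
    assume "(X, Y) \<in> S1 \<union> S2"
    then consider "(X, Y) \<in> S1" | "(X, Y) \<in> S2"
      by blast
    then show "X \<subseteq> A" "Y \<subseteq> B" "\<And>x y. x \<in> X \<Longrightarrow> y \<in> Y \<Longrightarrow> R x y"
      using rectangle_coverD(2-4)[OF S1(1), of X Y] rectangle_coverD(2-4)[OF S2(1), of X Y]
        assms(3-6)
      by (cases; blast)+
  qed (use fin in auto)
  moreover have "(\<Sum>(X, Y) \<in> S1 \<union> S2. card X + card Y) \<le> s1 + s2"
    using S1(2) S2(2) sum_Un_nat[OF fin, of "\<lambda>(X, Y). card X + card Y"] by linarith
  ultimately show ?thesis
    unfolding coverable_def by blast
qed

section \<open>Binary recursion for comparisons\<close>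

text \<open>Halving the interval at \<open>h\<close> leaves two comparisons of half the length and
  one mixed block on which \<open>f a < g b\<close> always holds. Only there must \<open>R\<close>
  itself be covered, at rate \<open>c\<close>. Each element enters at most one mixed block per
  level, hence the factor \<open>m\<close>.\<close>

lemma coverable_less_interval:
  fixes f :: "'a \<Rightarrow> nat" and g :: "'b \<Rightarrow> nat"
  assumes "finite A" "finite B"
    and "\<And>a. a \<in> A \<Longrightarrow> k \<le> f a \<and> f a < k + 2 ^ m"
    and "\<And>b. b \<in> B \<Longrightarrow> k \<le> g b \<and> g b < k + 2 ^ m"
    and "\<And>X Y. X \<subseteq> A \<Longrightarrow> Y \<subseteq> B \<Longrightarrow> (\<And>x y. x \<in> X \<Longrightarrow> y \<in> Y \<Longrightarrow> f x < g y)
           \<Longrightarrow> coverable R X Y (c * (card X + card Y))"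
  shows "coverable (\<lambda>a b. f a < g b \<and> R a b) A B (m * c * (card A + card B))"
  using assms
proof (induction m arbitrary: k A B)
  case 0
  \<comment> \<open>The interval has length one, so \<open>f a = k = g b\<close>.\<close>
  then show ?case by (intro coverable_none) fastforce
next
  case (Suc m)
  define h where "h = k + 2 ^ m"
  define A0 A1 where "A0 = {a \<in> A. f a < h}" and "A1 = {a \<in> A. h \<le> f a}"
  define B0 B1 where "B0 = {b \<in> B. g b < h}" and "B1 = {b \<in> B. h \<le> g b}"
  let ?R = "\<lambda>a b. f a < g b \<and> R a b"
  note defs = A0_def A1_def B0_def B1_def
  have top: "k + 2 ^ Suc m = h + 2 ^ m"
    by (simp add: h_def)
  have sub: "A0 \<subseteq> A" "A1 \<subseteq> A" "B0 \<subseteq> B" "B1 \<subseteq> B"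
    by (auto simp: defs)
  have fin: "finite A0" "finite A1" "finite B0" "finite B1"
    using sub Suc.prems(1,2) by (auto intro: finite_subset)
  have "A = A0 \<union> A1" "A0 \<inter> A1 = {}" "B = B0 \<union> B1" "B0 \<inter> B1 = {}"
    by (auto simp: defs)
  then have cards: "card A = card A0 + card A1" "card B = card B0 + card B1"
    using fin by (simp_all add: card_Un_disjoint)
  have low: "coverable ?R A0 B0 (m * c * (card A0 + card B0))"
  proof (rule Suc.IH[of _ _ k])
    show "coverable R X Y (c * (card X + card Y))"
      if "X \<subseteq> A0" "Y \<subseteq> B0" "\<And>x y. x \<in> X \<Longrightarrow> y \<in> Y \<Longrightarrow> f x < g y" for X Y
      using that sub by (intro Suc.prems(5)) auto
  qed (use fin Suc.prems(3,4) in \<open>auto simp: defs h_def\<close>)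
  have high: "coverable ?R A1 B1 (m * c * (card A1 + card B1))"
  proof (rule Suc.IH[of _ _ h])
    show "coverable R X Y (c * (card X + card Y))"
      if "X \<subseteq> A1" "Y \<subseteq> B1" "\<And>x y. x \<in> X \<Longrightarrow> y \<in> Y \<Longrightarrow> f x < g y" for X Y
      using that sub by (intro Suc.prems(5)) auto
  qed (use fin Suc.prems(3,4)[unfolded top] in \<open>auto simp: defs\<close>)
  have less: "f x < g y" if "x \<in> A0" "y \<in> B1" for x y
    using that by (auto simp: defs)
  have "coverable R A0 B1 (c * (card A0 + card B1))"
    using sub less by (intro Suc.prems(5)) auto
  then have mid: "coverable ?R A0 B1 (c * (card A0 + card B1))"
    using less by (subst coverable_cong[where R' = R]) auto
  \<comment> \<open>The block of \<open>A1\<close> and \<open>B0\<close> contributes nothing, since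
    \<open>g b < h \<le> f a\<close> there.\<close>
  have "coverable ?R A B1 (c * (card A0 + card B1) + m * c * (card A1 + card B1))"
    by (rule coverable_join[OF mid high]) (auto simp: defs)
  then have "coverable ?R A B (m * c * (card A0 + card B0) +
      (c * (card A0 + card B1) + m * c * (card A1 + card B1)))"
    by (rule coverable_join[OF low]) (auto simp: defs)
  then show ?case
    by (rule coverable_mono) (simp add: cards algebra_simps)
qed

lemma coverable_less:
  fixes f :: "'a \<Rightarrow> nat" and g :: "'b \<Rightarrow> nat"
  assumes "finite A" "finite B"
    and "\<And>a. a \<in> A \<Longrightarrow> f a < 2 ^ m" "\<And>b. b \<in> B \<Longrightarrow> g b < 2 ^ m"
    and "\<And>X Y. X \<subseteq> A \<Longrightarrow> Y \<subseteq> B \<Longrightarrow> (\<And>x y. x \<in> X \<Longrightarrow> y \<in> Y \<Longrightarrow> f x < g y)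
           \<Longrightarrow> coverable R X Y (c * (card X + card Y))"
  shows "coverable (\<lambda>a b. f a < g b \<and> R a b) A B (m * c * (card A + card B))"
  using assms by (intro coverable_less_interval[where k = 0]) auto

section \<open>Covering the edges of a capped graph\<close>

text \<open>Hypothesis \<open>cap\<close> is the capped condition for \<open>X\<close> entirely
  before \<open>Y\<close>, where \<open>j < k\<close> is automatic. It turns \<open>E\<close> into
  two nested comparisons, each costing a factor \<open>m\<close>.\<close>

lemma coverable_capped_rectangle:
  fixes E :: "nat \<Rightarrow> nat \<Rightarrow> bool"
  assumes fin: "finite X" "finite Y"
    and bound: "\<And>x. x \<in> X \<union> Y \<Longrightarrow> Suc x < 2 ^ m"
    and cap: "\<And>i j k l. i \<in> X \<Longrightarrow> j \<in> X \<Longrightarrow> k \<in> Y \<Longrightarrow> l \<in> Y \<Longrightarrow> i < j \<Longrightarrow> k < l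
                \<Longrightarrow> E i k \<Longrightarrow> E j l \<Longrightarrow> E i l"
  shows "coverable E X Y (m * m * (card X + card Y))"
proof -
  \<comment> \<open>The dummy values make both comparisons below fail for vertices without neighbours.\<close>
  define p where "p i = Min (insert (2 ^ m - 1) {k \<in> Y. E i k})" for i
  define q where "q l = Max (insert 0 (Suc ` {j \<in> X. E j l}))" for l
  \<comment> \<open>Strict comparisons are what \<open>coverable_less\<close> resolves; the shift is
    put on \<open>l\<close> here and into \<open>q\<close> below. As \<open>Suc l < 2 ^ m\<close>,
    the dummy value of \<open>p\<close> exceeds \<open>l\<close>.\<close>
  have p_less: "p i < Suc l \<longleftrightarrow> (\<exists>k \<in> Y. E i k \<and> k \<le> l)" if "l \<in> Y" for i l
  proof -
    have "l < 2 ^ m - 1"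
      using bound[of l] that by auto
    then show ?thesis
      using fin unfolding p_def less_Suc_eq_le by (subst Min_le_iff) auto
  qed
  have less_q: "i < q l \<longleftrightarrow> (\<exists>j \<in> X. E j l \<and> i \<le> j)" for i l
    using fin unfolding q_def by (subst Max_gr_iff) (auto simp: less_Suc_eq_le)
  have p_bound: "p i < 2 ^ m" for i
  proof -
    have "p i \<le> 2 ^ m - 1"
      using fin unfolding p_def by (intro Min_le) auto
    then show ?thesis
      by (simp add: Suc_le_lessD le_diff_conv2 less_eq_Suc_le)
  qed
  have q_bound: "q l < 2 ^ m" for l
    using fin bound unfolding q_def by (subst Max_less_iff) auto
  \<comment> \<open>Forwards, take \<open>k = l\<close> and \<open>j = i\<close>. Backwards,
    \<open>cap\<close> applies unless \<open>k = l\<close> or \<open>j = i\<close>, where the edge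
    is already given. The conjunct \<open>True\<close> is the relation left for the innermost
    recursion, covered by a single rectangle at rate 1.\<close>
  have E_iff: "E i l \<longleftrightarrow> p i < Suc l \<and> i < q l \<and> True" if "i \<in> X" "l \<in> Y" for i l
    using cap[of i _ _ l] that unfolding p_less[OF that(2)] less_q
    by (metis le_neq_implies_less le_refl)
  have inner: "coverable (\<lambda>i l. i < q l \<and> True) X' Y' (m * (card X' + card Y'))"
    if "X' \<subseteq> X" "Y' \<subseteq> Y" for X' Y'
  proof -
    have "coverable (\<lambda>i l. i < q l \<and> True) X' Y' (m * 1 * (card X' + card Y'))"
    proof (rule coverable_less)
      show "coverable (\<lambda>_ _. True) X'' Y'' (1 * (card X'' + card Y''))"
        for X'' Y'' :: "nat set"
        using coverable_all[of X'' Y'' "\<lambda>_ _. True"] by simp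
      show "a < 2 ^ m" if "a \<in> X'" for a
        using bound[of a] \<open>a \<in> X'\<close> \<open>X' \<subseteq> X\<close> by auto
    qed (use fin that q_bound in \<open>auto intro: finite_subset\<close>)
    then show ?thesis by simp
  qed
  have "coverable (\<lambda>i l. p i < Suc l \<and> (i < q l \<and> True)) X Y (m * m * (card X + card Y))"
    by (rule coverable_less) (use fin p_bound bound inner in auto)
  then show ?thesis
    using E_iff by (subst coverable_cong) auto
qed

text \<open>Resolving \<open>a < b\<close> first produces blocks with all of \<open>X\<close> before
  \<open>Y\<close>, each covered at rate \<open>m * m\<close>. The factor 2 arises because both
  sides start as the whole vertex set.\<close>

lemma coverable_capped:
  fixes G :: "nat graph"
  assumes capped: "capped_graph G"
    and bound: "\<And>x. x \<in> verts G \<Longrightarrow> Suc x < 2 ^ m"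
  shows "coverable (\<lambda>a b. a < b \<and> {a, b} \<in> edges G) (verts G) (verts G)
           (m ^ 3 * (2 * card (verts G)))"
proof -
  have fin: "finite (verts G)"
    using capped by (simp add: capped_graph_def simple_graph_def)
  have cap: "{i, l} \<in> edges G"
    if "i \<in> verts G" "j \<in> verts G" "k \<in> verts G" "l \<in> verts G" "i < j" "j < k" "k < l"
      "{i, k} \<in> edges G" "{j, l} \<in> edges G" for i j k l
    using capped that unfolding capped_graph_def by blast
  have "coverable (\<lambda>a b. a < b \<and> {a, b} \<in> edges G) (verts G) (verts G)
      (m * (m * m) * (card (verts G) + card (verts G)))"
  proof (rule coverable_less)
    show "coverable (\<lambda>a b. {a, b} \<in> edges G) X Y (m * m * (card X + card Y))"
      if "X \<subseteq> verts G" "Y \<subseteq> verts G" "\<And>x y. x \<in> X \<Longrightarrow> y \<in> Y \<Longrightarrow> x < y" for X Y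
      using that fin bound
      by (intro coverable_capped_rectangle) (auto intro: finite_subset cap)
  qed (use fin bound in \<open>auto intro: Suc_lessD\<close>)
  then show ?thesis
    by (simp add: power3_eq_cube mult.assoc mult_2)
qed

section \<open>From rectangles to bicliques\<close>

text \<open>Orienting edges upwards makes the two sides of a rectangle disjoint, so it spans a
  biclique of \<open>G\<close>.\<close>

lemma biclique_cover_of_coverable:
  fixes G :: "'a::linorder graph"
  assumes simple: "simple_graph G"
    and cov: "coverable (\<lambda>a b. a < b \<and> {a, b} \<in> edges G) (verts G) (verts G) s"
  obtains \<H> where "biclique_cover G \<H>" "cover_size \<H> \<le> s"
proof -
  obtain S where "rectangle_cover (\<lambda>a b. a < b \<and> {a, b} \<in> edges G) (verts G) (verts G) S"
    and size: "(\<Sum>(X, Y) \<in> S. card X + card Y) \<le> s"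
    using cov unfolding coverable_def by auto
  then have finS: "finite S"
    and sub: "\<And>X Y. (X, Y) \<in> S \<Longrightarrow> X \<subseteq> verts G \<and> Y \<subseteq> verts G"
    and edge: "\<And>X Y x y. (X, Y) \<in> S \<Longrightarrow> x \<in> X \<Longrightarrow> y \<in> Y \<Longrightarrow> x < y \<and> {x, y} \<in> edges G"
    and covers: "\<And>a b. a \<in> verts G \<Longrightarrow> b \<in> verts G \<Longrightarrow> a < b \<Longrightarrow> {a, b} \<in> edges G
                   \<Longrightarrow> \<exists>X Y. (X, Y) \<in> S \<and> a \<in> X \<and> b \<in> Y"
    unfolding rectangle_cover_def by blast+
  define K :: "'a set \<times> 'a set \<Rightarrow> 'a graph" where
    "K = (\<lambda>(X, Y). (X \<union> Y, {{x, y} | x y. x \<in> X \<and> y \<in> Y}))"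
  \<comment> \<open>Bicliques must have nonempty sides.\<close>
  define T where "T = {(X, Y) \<in> S. X \<noteq> {} \<and> Y \<noteq> {}}"
  have finT: "finite T" and TS: "T \<subseteq> S"
    using finS by (auto simp: T_def intro: finite_subset)
  have good: "subgraph (K (X, Y)) G \<and> biclique (K (X, Y))" if XY: "(X, Y) \<in> T" for X Y
  proof -
    have XYS: "(X, Y) \<in> S" and ne: "X \<noteq> {}" "Y \<noteq> {}"
      using XY by (auto simp: T_def)
    have XY_sub: "X \<union> Y \<subseteq> verts G"
      using sub[OF XYS] by auto
    then have finXY: "finite (X \<union> Y)"
      using simple by (auto simp: simple_graph_def intro: finite_subset)
    have K_edges: "edges (K (X, Y)) \<subseteq> edges G"
      using edge[OF XYS] by (auto simp: K_def)
    then have simple_K: "simple_graph (K (X, Y))"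
      using simple finXY unfolding simple_graph_def K_def by auto
    have "X \<inter> Y = {}"
      using edge[OF XYS] by blast
    then have "biclique (K (X, Y))"
      unfolding biclique_def using simple_K ne
      by (intro conjI exI[of _ X] exI[of _ Y]) (auto simp: K_def)
    moreover have "subgraph (K (X, Y)) G"
      using simple simple_K K_edges XY_sub by (auto simp: subgraph_def K_def)
    ultimately show ?thesis by simp
  qed
  have "\<exists>H \<in> K ` T. e \<in> edges H" if e: "e \<in> edges G" for e
  proof -
    have "card e = 2" "e \<subseteq> verts G"
      using simple e by (auto simp: simple_graph_def)
    then obtain a b where ab: "e = {a, b}" "a < b"
      by (metis card_2_iff insert_commute linorder_neqE)
    with \<open>e \<subseteq> verts G\<close> e obtain X Y where XY: "(X, Y) \<in> S" "a \<in> X" "b \<in> Y"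
      using covers[of a b] by auto
    then have "(X, Y) \<in> T" "e \<in> edges (K (X, Y))"
      using ab by (auto simp: T_def K_def)
    then show ?thesis by blast
  qed
  then have "biclique_cover G (K ` T)"
    using good unfolding biclique_cover_def by auto
  moreover have "cover_size (K ` T) \<le> s"
  proof -
    \<comment> \<open>Taking the image under \<open>K\<close> can only merge summands.\<close>
    have "cover_size (K ` T) \<le> (\<Sum>t \<in> T. card (verts (K t)))"
      unfolding cover_size_def using sum_image_le[OF finT, of "\<lambda>H. card (verts H)" K]
      by (simp add: o_def)
    also have "\<dots> \<le> (\<Sum>(X, Y) \<in> T. card X + card Y)"
      by (intro sum_mono) (auto simp: K_def card_Un_le)
    also have "\<dots> \<le> (\<Sum>(X, Y) \<in> S. card X + card Y)"
      using finS TS by (intro sum_mono2) auto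
    finally show ?thesis
      using size by simp
  qed
  ultimately show ?thesis
    using that by blast
qed

section \<open>Logarithmic bound and conclusion\<close>

lemma ex_power2_bound:
  assumes "n \<ge> 2"
  obtains m :: nat where "n + 1 < 2 ^ m" "real m \<le> 6 * ln (real n)"
proof -
  define m where "m = (LEAST m. n + 1 < (2::nat) ^ m)"
  have "n + 1 < (2::nat) ^ (n + 1)"
    by (rule less_exp)
  then have m: "n + 1 < 2 ^ m"
    unfolding m_def by (rule LeastI)
  then have "m \<noteq> 0"
    by (intro notI) simp
  then have "\<not> n + 1 < 2 ^ (m - 1)"
    unfolding m_def by (intro not_less_Least) simp
  moreover have "(2::nat) ^ m = 2 * 2 ^ (m - 1)"
    using \<open>m \<noteq> 0\<close> by (simp flip: power_Suc)
  ultimately have "2 ^ m \<le> 2 * (n + 1)"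
    by simp
  also have "\<dots> \<le> 4 * n"
    using assms by simp
  \<comment> \<open>A power of \<open>n\<close> absorbs the constant 4; the exponent must be 3
    because of \<open>n = 2\<close>.\<close>
  also have "\<dots> \<le> n ^ 3"
    using mult_le_mono[OF mult_le_mono[OF assms assms] le_refl[of n]] by (simp add: power3_eq_cube)
  finally have "real 2 ^ m \<le> real n ^ 3"
    by (metis of_nat_le_iff of_nat_power)
  then have "ln (real 2 ^ m) \<le> ln (real n ^ 3)"
    using assms by (subst ln_le_cancel_iff) auto
  then have "m * ln 2 \<le> 3 * ln n"
    using assms by (simp add: ln_realpow)
  \<comment> \<open>From \<open>ln (1 / 2) \<le> - 1 / 2\<close> one gets
    \<open>ln 2 \<ge> 1 / 2\<close>, which turns the exponent 3 into the constant 6.\<close>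
  moreover have "real m * (1 / 2) \<le> m * ln 2"
    using ln_le_minus_one[of "1 / 2 :: real"] by (intro mult_left_mono) (auto simp: ln_div)
  ultimately show ?thesis
    using that[OF m] by simp
qed

theorem theorem13:
  shows "\<exists>C::real. \<forall>(n::nat) (G::nat graph).
           n \<ge> 2 \<and> verts G = {1..n} \<and> capped_graph G \<longrightarrow>
           (\<exists>\<H>. biclique_cover G \<H> \<and> real (cover_size \<H>) \<le> C * real n * ln (real n) ^ 3)"
\<comment> \<open>The constant is \<open>6 ^ 3 * 2\<close>.\<close>
proof (intro exI[of _ 432] allI impI)
  fix n :: nat and G :: "nat graph"
  assume asm: "n \<ge> 2 \<and> verts G = {1..n} \<and> capped_graph G"
  obtain m where m: "n + 1 < 2 ^ m" "real m \<le> 6 * ln (real n)"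
    using ex_power2_bound asm by blast
  have "coverable (\<lambda>a b. a < b \<and> {a, b} \<in> edges G) (verts G) (verts G)
      (m ^ 3 * (2 * card (verts G)))"
    using asm m by (intro coverable_capped) auto
  then obtain \<H> where H: "biclique_cover G \<H>" "cover_size \<H> \<le> m ^ 3 * (2 * card (verts G))"
    using asm biclique_cover_of_coverable[of G] unfolding capped_graph_def by blast
  have "real (cover_size \<H>) \<le> real (m ^ 3 * (2 * card (verts G)))"
    using H(2) by (rule of_nat_mono)
  also have "\<dots> = real m ^ 3 * (2 * n)"
    using asm by simp
  also have "\<dots> \<le> (6 * ln n) ^ 3 * (2 * n)"
    using m(2) by (intro mult_right_mono power_mono) auto
  also have "\<dots> = 432 * real n * ln (real n) ^ 3"
    by (simp add: power_mult_distrib)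
  finally show "\<exists>\<H>. biclique_cover G \<H> \<and> real (cover_size \<H>) \<le> 432 * real n * ln (real n) ^ 3"
    using H(1) by blast
qed

end
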